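(* Let $\rho:\mathfrak{sl}(2)\to\mathrm{Diff}^1(\mathbb{C}[[z]])$ be a homomorphism of Lie algebras such that $\rho(L_0)$ is of first order. Then there exist $\gamma\in\mathrm{SGL}_{\mathbb{C}[[z]]}(\mathbb{C}[[z]])$ and $c\in\mathbb{C}$ such that $$\mathrm{Im}(\rho^\gamma)=\langle\,\partial,\ z\partial-c,\ z^2\partial-2cz\,\rangle .$$
   Context: $\mathfrak{sl}(2)$ is the complex Lie algebra with basis $L_{-1},L_0,L_1$ and $[L_i,L_j]=(i-j)L_{i+j}$. $\mathrm{Diff}^1(\mathbb{C}[[z]])$ is the Lie algebra (under commutator) of operators $\xi_1\partial+\xi_0$ with $\xi_0,\xi_1\in\mathbb{C}[[z]]$, $\partial=\frac{\partial}{\partial z}$; such an operator is of first order if $\xi_1\neq0$. $\mathrm{SGL}_{\mathbb{C}[[z]]}(\mathbb{C}[[z]])$ is the group of semilinear transformations: $\mathbb{C}$-linear automorphisms $\gamma$ of $\mathbb{C}[[z]]$ for which there is a $\mathbb{C}$-algebra automorphism $\Phi$ of $\mathbb{C}[[z]]$ with $\gamma(fv)=\Phi(f)\gamma(v)$ for all $f,v\in\mathbb{C}[[z]]$. It acts on representations by $\rho^\gamma(L_k)=\gamma\circ\rho(L_k)\circ\gamma^{-1}$. $\langle\cdots\rangle$ denotes the complex linear span. *)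

theory Defs
  imports
    "HOL-Computational_Algebra.Formal_Power_Series"
    "HOL-Library.Function_Algebras"
begin

subsection \<open>Lie algebras\<close>

text \<open>
  A Lie algebra over a field, with underlying space a linear subspace of an ambient vector space;
  the bracket is only required to behave well on that subspace.
\<close>

locale lie_algebra = vector_space scale
  for scale :: "'a::field \<Rightarrow> 'v::ab_group_add \<Rightarrow> 'v" +
  fixes carr :: "'v set" and bracket :: "'v \<Rightarrow> 'v \<Rightarrow> 'v"
  assumes subspace_carr: "subspace carr"
    and bracket_closed: "x \<in> carr \<Longrightarrow> y \<in> carr \<Longrightarrow> bracket x y \<in> carr"
    and bracket_add_left: "x \<in> carr \<Longrightarrow> y \<in> carr \<Longrightarrow> z \<in> carr \<Longrightarrow>
          bracket (x + y) z = bracket x z + bracket y z"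
    and bracket_add_right: "x \<in> carr \<Longrightarrow> y \<in> carr \<Longrightarrow> z \<in> carr \<Longrightarrow>
          bracket x (y + z) = bracket x y + bracket x z"
    and bracket_scale_left: "x \<in> carr \<Longrightarrow> y \<in> carr \<Longrightarrow>
          bracket (scale c x) y = scale c (bracket x y)"
    and bracket_scale_right: "x \<in> carr \<Longrightarrow> y \<in> carr \<Longrightarrow>
          bracket x (scale c y) = scale c (bracket x y)"
    and bracket_alternating: "x \<in> carr \<Longrightarrow> bracket x x = 0"
    and jacobi: "x \<in> carr \<Longrightarrow> y \<in> carr \<Longrightarrow> z \<in> carr \<Longrightarrow>
          bracket x (bracket y z) + bracket y (bracket z x) + bracket z (bracket x y) = 0"

subsection \<open>The Lie algebra sl(2)\<close>

text \<open>The element \<open>SL2 a b c\<close> stands for \<open>a L\<^sub>-\<^sub>1 + b L\<^sub>0 + c L\<^sub>1\<close>.\<close>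

datatype sl2 = SL2 complex complex complex

instantiation sl2 :: ab_group_add
begin

definition zero_sl2 :: sl2 where
  "zero_sl2 = SL2 0 0 0"

fun plus_sl2 :: "sl2 \<Rightarrow> sl2 \<Rightarrow> sl2" where
  "plus_sl2 (SL2 a b c) (SL2 a' b' c') = SL2 (a + a') (b + b') (c + c')"

fun uminus_sl2 :: "sl2 \<Rightarrow> sl2" where
  "uminus_sl2 (SL2 a b c) = SL2 (- a) (- b) (- c)"

definition minus_sl2 :: "sl2 \<Rightarrow> sl2 \<Rightarrow> sl2" where
  "minus_sl2 x y = x + (- y)"

instance
proof
  fix x y z :: sl2
  show "x + y + z = x + (y + z)" by (cases x; cases y; cases z) simp
  show "x + y = y + x" by (cases x; cases y) simp
  show "0 + x = x" by (cases x) (simp add: zero_sl2_def)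
  show "- x + x = 0" by (cases x) (simp add: zero_sl2_def)
  show "x - y = x + - y" by (simp add: minus_sl2_def)
qed

end

fun sl2_scale :: "complex \<Rightarrow> sl2 \<Rightarrow> sl2" where
  "sl2_scale t (SL2 a b c) = SL2 (t * a) (t * b) (t * c)"

text \<open>Only the indices -1, 0, 1 are meaningful.\<close>

definition L :: "int \<Rightarrow> sl2" where
  "L k = (if k = -1 then SL2 1 0 0 else if k = 0 then SL2 0 1 0
          else if k = 1 then SL2 0 0 1 else 0)"

fun sl2_coord :: "sl2 \<Rightarrow> int \<Rightarrow> complex" where
  "sl2_coord (SL2 a b c) k = (if k = -1 then a else if k = 0 then b else if k = 1 then c else 0)"

text \<open>
  The bilinear extension of \<open>[L\<^sub>i, L\<^sub>j] = (i - j) L\<^sub>i\<^sub>+\<^sub>j\<close>.  An index \<open>i + j\<close> outside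
  the range -1, 0, 1 only arises for \<open>i = j\<close>, where the coefficient vanishes.
\<close>

definition sl2_bracket :: "sl2 \<Rightarrow> sl2 \<Rightarrow> sl2" where
  "sl2_bracket x y =
     (\<Sum>i\<in>{-1,0,1}. \<Sum>j\<in>{-1,0,1}.
        sl2_scale (sl2_coord x i * sl2_coord y j * of_int (i - j)) (L (i + j)))"

interpretation sl2: vector_space sl2_scale
proof
  fix a b :: complex and x y :: sl2
  show "sl2_scale a (x + y) = sl2_scale a x + sl2_scale a y"
    by (cases x; cases y) (simp add: algebra_simps)
  show "sl2_scale (a + b) x = sl2_scale a x + sl2_scale b x"
    by (cases x) (simp add: algebra_simps)
  show "sl2_scale a (sl2_scale b x) = sl2_scale (a * b) x"
    by (cases x) simp
  show "sl2_scale 1 x = x"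
    by (cases x) simp
qed

lemma sl2_bracket_SL2:
  "sl2_bracket (SL2 a b c) (SL2 a' b' c') =
     SL2 (b * a' - a * b') (2 * (c * a' - a * c')) (c * b' - b * c')"
  by (simp add: sl2_bracket_def L_def zero_sl2_def algebra_simps)

lemma sl2_bracket_L:
  assumes "i \<in> {-1, 0, 1}" "j \<in> {-1, 0, 1}"
  shows "sl2_bracket (L i) (L j) = sl2_scale (of_int (i - j)) (L (i + j))"
  using assms by (auto simp: L_def sl2_bracket_SL2 zero_sl2_def)

lemma sl2_expand:
  "x = sl2_scale (sl2_coord x (-1)) (L (-1)) + sl2_scale (sl2_coord x 0) (L 0)
       + sl2_scale (sl2_coord x 1) (L 1)"
  by (cases x) (simp add: L_def)

lemma sl2_coord_unique:
  assumes "x = sl2_scale a (L (-1)) + sl2_scale b (L 0) + sl2_scale c (L 1)"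
  shows "sl2_coord x (-1) = a \<and> sl2_coord x 0 = b \<and> sl2_coord x 1 = c"
  using assms by (simp add: L_def)

lemma lie_algebra_sl2: "lie_algebra sl2_scale UNIV sl2_bracket"
proof
  fix x y z :: sl2 and t :: complex
  show "sl2.subspace UNIV" by (rule sl2.subspace_UNIV)
  show "sl2_bracket x y \<in> UNIV" by simp
  show "sl2_bracket (x + y) z = sl2_bracket x z + sl2_bracket y z"
    by (cases x; cases y; cases z) (simp add: sl2_bracket_SL2 algebra_simps)
  show "sl2_bracket x (y + z) = sl2_bracket x y + sl2_bracket x z"
    by (cases x; cases y; cases z) (simp add: sl2_bracket_SL2 algebra_simps)
  show "sl2_bracket (sl2_scale t x) y = sl2_scale t (sl2_bracket x y)"
    by (cases x; cases y) (simp add: sl2_bracket_SL2 algebra_simps)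
  show "sl2_bracket x (sl2_scale t y) = sl2_scale t (sl2_bracket x y)"
    by (cases x; cases y) (simp add: sl2_bracket_SL2 algebra_simps)
  show "sl2_bracket x x = 0"
    by (cases x) (simp add: sl2_bracket_SL2 zero_sl2_def)
  show "sl2_bracket x (sl2_bracket y z) + sl2_bracket y (sl2_bracket z x)
        + sl2_bracket z (sl2_bracket x y) = 0"
    by (cases x; cases y; cases z) (simp add: sl2_bracket_SL2 zero_sl2_def algebra_simps)
qed

subsection \<open>Differential operators of order at most one on formal power series\<close>

type_synonym fps_op = "complex fps \<Rightarrow> complex fps"

text \<open>
  Sums of operators are the pointwise ones.  (The product of two operators provided by the same
  type class instance is pointwise too and is not used here.)
\<close>

definition fps_op_scale :: "complex \<Rightarrow> fps_op \<Rightarrow> fps_op" where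
  "fps_op_scale c D = (\<lambda>f. fps_const c * D f)"

interpretation fps_op: vector_space fps_op_scale
  by standard
    (auto simp: fps_op_scale_def fun_eq_iff algebra_simps simp flip: fps_const_add fps_const_mult)

definition commutator :: "fps_op \<Rightarrow> fps_op \<Rightarrow> fps_op" where
  "commutator D E = (D \<circ> E) - (E \<circ> D)"

text \<open>The operator \<open>\<xi>\<^sub>1 \<partial> + \<xi>\<^sub>0\<close>.\<close>

definition diff_op :: "complex fps \<Rightarrow> complex fps \<Rightarrow> fps_op" where
  "diff_op \<xi>1 \<xi>0 = (\<lambda>f. \<xi>1 * fps_deriv f + \<xi>0 * f)"

definition Diff1 :: "fps_op set" where
  "Diff1 = {diff_op \<xi>1 \<xi>0 | \<xi>1 \<xi>0. True}"

definition first_order :: "fps_op \<Rightarrow> bool" where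
  "first_order D \<longleftrightarrow> (\<exists>\<xi>1 \<xi>0. D = diff_op \<xi>1 \<xi>0 \<and> \<xi>1 \<noteq> 0)"

lemma diff_op_eq_iff: "diff_op a b = diff_op a' b' \<longleftrightarrow> a = a' \<and> b = b'"
proof
  assume eq: "diff_op a b = diff_op a' b'"
  from fun_cong[OF eq, of 1] have b: "b = b'" by (simp add: diff_op_def)
  from fun_cong[OF eq, of fps_X] b have "a = a'" by (simp add: diff_op_def)
  with b show "a = a' \<and> b = b'" by simp
qed simp

lemma commutator_diff_op:
  "commutator (diff_op a b) (diff_op a' b') =
     diff_op (a * fps_deriv a' - a' * fps_deriv a) (a * fps_deriv b' - a' * fps_deriv b)"
  by (rule ext) (simp add: commutator_def diff_op_def algebra_simps)

lemma diff_op_add: "diff_op a b + diff_op a' b' = diff_op (a + a') (b + b')"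
  by (rule ext) (simp add: diff_op_def algebra_simps)

lemma diff_op_scale: "fps_op_scale c (diff_op a b) = diff_op (fps_const c * a) (fps_const c * b)"
  by (rule ext) (simp add: fps_op_scale_def diff_op_def algebra_simps)

lemma diff_op_zero: "0 = diff_op 0 0"
  by (rule ext) (simp add: diff_op_def)

lemma lie_algebra_Diff1: "lie_algebra fps_op_scale Diff1 commutator"
proof
  show "fps_op.subspace Diff1"
    unfolding fps_op.subspace_def Diff1_def
    using diff_op_add diff_op_scale diff_op_zero by fastforce
  show "commutator D E \<in> Diff1" if "D \<in> Diff1" "E \<in> Diff1" for D E
    using that unfolding Diff1_def by clarify (simp only: commutator_diff_op, blast)
qed (auto simp: Diff1_def commutator_diff_op diff_op_add diff_op_scale diff_op_zero diff_op_eq_iff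
      algebra_simps)

text \<open>Homomorphisms of complex Lie algebras from sl(2) to \<open>Diff1\<close>.\<close>

definition sl2_hom_Diff1 :: "(sl2 \<Rightarrow> fps_op) \<Rightarrow> bool" where
  "sl2_hom_Diff1 \<rho> \<longleftrightarrow>
     Vector_Spaces.linear sl2_scale fps_op_scale \<rho> \<and>
     range \<rho> \<subseteq> Diff1 \<and>
     (\<forall>x y. \<rho> (sl2_bracket x y) = commutator (\<rho> x) (\<rho> y))"

subsection \<open>Semilinear transformations of the ring of formal power series\<close>

definition fps_scale :: "complex \<Rightarrow> complex fps \<Rightarrow> complex fps" where
  "fps_scale c f = fps_const c * f"

interpretation fps: vector_space fps_scale
  by standard (auto simp: fps_scale_def algebra_simps simp flip: fps_const_add fps_const_mult)

definition fps_alg_aut :: "fps_op \<Rightarrow> bool" where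
  "fps_alg_aut \<Phi> \<longleftrightarrow>
     bij \<Phi> \<and> Vector_Spaces.linear fps_scale fps_scale \<Phi> \<and>
     \<Phi> 1 = 1 \<and> (\<forall>f g. \<Phi> (f * g) = \<Phi> f * \<Phi> g)"

definition SGL :: "fps_op set" where
  "SGL = {\<gamma>. bij \<gamma> \<and> Vector_Spaces.linear fps_scale fps_scale \<gamma> \<and>
             (\<exists>\<Phi>. fps_alg_aut \<Phi> \<and> (\<forall>f v. \<gamma> (f * v) = \<Phi> f * \<gamma> v))}"

definition conj_rep :: "fps_op \<Rightarrow> (sl2 \<Rightarrow> fps_op) \<Rightarrow> (sl2 \<Rightarrow> fps_op)" where
  "conj_rep \<gamma> \<rho> = (\<lambda>x. \<gamma> \<circ> \<rho> x \<circ> inv \<gamma>)"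

end

theory Submission
  imports Defs
begin

text \<open>
  Write \<open>A\<close>, \<open>B\<close>, \<open>C\<close> for the images of \<open>L\<^sub>-\<^sub>1\<close>, \<open>L\<^sub>0\<close>, \<open>L\<^sub>1\<close>, so that \<open>[B, A] = A\<close>,
  \<open>[C, B] = C\<close>, \<open>[C, A] = 2 B\<close> and the image of \<open>\<rho>\<close> is the span of \<open>A\<close>, \<open>B\<close>, \<open>C\<close>.

  The vector field part of \<open>A\<close> or that of \<open>C\<close> does not vanish at the origin
  (\<open>triple_nonvanishing\<close>).  Otherwise the field of \<open>B\<close>, which is half their bracket, vanishes to
  second order.  Bracketing with such a field strictly raises the order of vanishing, so the field
  of \<open>A\<close>, which this bracket reproduces, must be zero.  Then the field of \<open>B\<close> is
  zero too, and \<open>B\<close> is not of first order.  Since \<open>(C, -B, A)\<close> satisfies the same relations and has the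
  same span, \<open>A\<close> may be taken to be the nonvanishing one.

  A nonvanishing operator \<open>a \<partial> + \<alpha>\<close> is straightened to \<open>\<partial>\<close> by a semilinear transformation
  (\<open>straightening\<close>): the coordinate \<open>w\<close> with \<open>w' = 1 / a\<close> turns \<open>a \<partial>\<close> into \<open>\<partial>\<close>, and the factor
  \<open>g\<close> with \<open>g' / g = \<alpha> / a\<close> absorbs the term of order zero.  The map \<open>f \<mapsto> (g f) \<circ> w\<^sup>-\<^sup>1\<close>
  (\<open>weighted_subst\<close>) does both, and it conjugates operators of order at most one to such operators
  (\<open>conjugate_diff_op\<close>).

  Once \<open>A = \<partial>\<close>, the relations leave only \<open>B = b \<partial> + c\<close> and \<open>C = b\<^sup>2 \<partial> + 2 b c\<close> with
  \<open>b = t - z\<close> for constants \<open>c\<close> and \<open>t\<close> (\<open>triple_with_partial\<close>).  The constant \<open>t\<close> only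
  replaces the basis of the span by another one (\<open>span_normal_form\<close>).
\<close>

unbundle fps_syntax

section \<open>Weighted substitutions\<close>

definition weighted_subst :: "complex fps \<Rightarrow> complex fps \<Rightarrow> fps_op" where
  "weighted_subst g v f = (g * f) oo v"

lemma fps_inv_nth_0: "fps_inv w $ 0 = 0"
  by (simp add: fps_inv_def)

lemma fps_compose_inv_right:
  fixes w :: "complex fps"
  assumes "w $ 0 = 0" "w $ 1 \<noteq> 0"
  shows "w oo fps_inv w = fps_X"
proof -
  have "(w oo fps_inv w) oo w = w oo (fps_inv w oo w)"
    using assms by (simp add: fps_compose_assoc fps_inv_nth_0)
  also have "\<dots> = fps_X oo w"
    using assms by (simp add: fps_inv)
  finally show ?thesis
    using fps_compose_inj_right[OF assms] by blast
qed

lemma bij_weighted_subst: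
  assumes "w $ 0 = 0" "w $ 1 \<noteq> 0" "g $ 0 \<noteq> 0"
  shows "bij (weighted_subst g (fps_inv w))"
proof (rule o_bij)
  let ?G = "\<lambda>f. inverse g * (f oo w)"
  have g: "inverse g * g = 1" "g * inverse g = 1"
    using assms(3) by (simp_all add: inverse_mult_eq_1 inverse_mult_eq_1')
  have "?G (weighted_subst g (fps_inv w) f) = f" for f
  proof -
    have "((g * f) oo fps_inv w) oo w = (g * f) oo (fps_inv w oo w)"
      using assms by (simp add: fps_compose_assoc fps_inv_nth_0)
    then have "?G (weighted_subst g (fps_inv w) f) = (inverse g * g) * f"
      using assms by (simp add: weighted_subst_def fps_inv mult.assoc)
    then show ?thesis using g by simp
  qed
  then show "?G \<circ> weighted_subst g (fps_inv w) = id"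
    by (simp add: fun_eq_iff)
  have "weighted_subst g (fps_inv w) (?G f) = f" for f
  proof -
    have "g * ?G f = f oo w"
      using g(2) by (simp flip: mult.assoc)
    moreover have "(f oo w) oo fps_inv w = f oo (w oo fps_inv w)"
      using assms by (simp add: fps_compose_assoc fps_inv_nth_0)
    ultimately show ?thesis
      using fps_compose_inv_right[OF assms(1,2)]
      by (simp only: weighted_subst_def fps_compose_fps_X)
  qed
  then show "weighted_subst g (fps_inv w) \<circ> ?G = id"
    by (simp add: fun_eq_iff)
qed

lemma linear_weighted_subst:
  assumes "v $ 0 = 0"
  shows "Vector_Spaces.linear fps_scale fps_scale (weighted_subst g v)"
  unfolding Vector_Spaces.linear_iff
  using fps.vector_space_axioms assms
  by (auto simp: weighted_subst_def fps_scale_def ring_distribs fps_compose_add_distrib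
      fps_compose_mult_distrib)

text \<open>The algebra automorphism accompanying such a map is the substitution itself.\<close>

lemma weighted_subst_in_SGL:
  assumes "w $ 0 = 0" "w $ 1 \<noteq> 0" "g $ 0 \<noteq> 0"
  shows "weighted_subst g (fps_inv w) \<in> SGL"
proof -
  have "fps_alg_aut (weighted_subst 1 (fps_inv w))"
    using assms bij_weighted_subst[of w 1] linear_weighted_subst[of "fps_inv w" 1]
    by (simp add: fps_alg_aut_def weighted_subst_def fps_compose_mult_distrib fps_inv_nth_0)
  moreover have "weighted_subst g (fps_inv w) (f * u) =
      weighted_subst 1 (fps_inv w) f * weighted_subst g (fps_inv w) u" for f u
    by (simp add: weighted_subst_def fps_compose_mult_distrib fps_inv_nth_0)
  ultimately show ?thesis
    using assms bij_weighted_subst[of w g] linear_weighted_subst[of "fps_inv w" g]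
    by (auto simp: SGL_def fps_inv_nth_0)
qed

section \<open>Conjugation of differential operators\<close>

definition conjugate :: "fps_op \<Rightarrow> fps_op \<Rightarrow> fps_op" where
  "conjugate \<gamma> D = \<gamma> \<circ> D \<circ> inv \<gamma>"

lemma conjugate_eqI:
  assumes "bij \<gamma>" "\<And>f. \<gamma> (D f) = E (\<gamma> f)"
  shows "conjugate \<gamma> D = E"
  using assms by (simp add: conjugate_def fun_eq_iff bij_is_surj surj_f_inv_f)

lemma SGL_D:
  assumes "\<gamma> \<in> SGL"
  shows "bij \<gamma>" "\<gamma> (f + g) = \<gamma> f + \<gamma> g" "\<gamma> (f - g) = \<gamma> f - \<gamma> g"
    "\<gamma> (fps_const t * f) = fps_const t * \<gamma> f"
proof -
  from assms have lin: "Vector_Spaces.linear fps_scale fps_scale \<gamma>" and "bij \<gamma>"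
    by (auto simp: SGL_def)
  then show "bij \<gamma>" by simp
  interpret module_hom fps_scale fps_scale \<gamma>
    using lin by (simp add: module_hom_iff_linear)
  show "\<gamma> (f + g) = \<gamma> f + \<gamma> g" "\<gamma> (f - g) = \<gamma> f - \<gamma> g"
    by (rule add, rule diff)
  show "\<gamma> (fps_const t * f) = fps_const t * \<gamma> f"
    using scale[of t f] by (simp add: fps_scale_def)
qed

lemma linear_conjugate:
  assumes "\<gamma> \<in> SGL"
  shows "Vector_Spaces.linear fps_op_scale fps_op_scale (conjugate \<gamma>)"
  unfolding Vector_Spaces.linear_iff
  using fps_op.vector_space_axioms SGL_D[OF assms]
  by (auto simp: conjugate_def fps_op_scale_def fun_eq_iff)

lemma conjugate_commutator:
  assumes "\<gamma> \<in> SGL"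
  shows "conjugate \<gamma> (commutator D E) = commutator (conjugate \<gamma> D) (conjugate \<gamma> E)"
  using SGL_D[OF assms]
  by (auto simp: conjugate_def commutator_def fun_eq_iff bij_is_inj inv_f_f)

text \<open>
  With \<open>v = w\<^sup>-\<^sup>1\<close>, the chain rule gives \<open>((g f) \<circ> v)' = ((g f)' \<circ> v) \<cdot> v'\<close>, and
  \<open>(w' \<circ> v) \<cdot> v' = 1\<close>.  So multiplying the first-order coefficient by \<open>w'\<close> compensates the
  substitution, and subtracting \<open>a g' / g\<close> compensates the derivative of the factor \<open>g\<close>.
\<close>

lemma conjugate_diff_op:
  assumes w: "w $ 0 = 0" "w $ 1 \<noteq> 0" and g: "g $ 0 \<noteq> 0"
  shows "conjugate (weighted_subst g (fps_inv w)) (diff_op a b) =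
    diff_op ((a * fps_deriv w) oo fps_inv w)
      ((b - a * fps_deriv g * inverse g) oo fps_inv w)"
proof (rule conjugate_eqI)
  let ?v = "fps_inv w"
  show "bij (weighted_subst g ?v)"
    using assms by (rule bij_weighted_subst)
  fix f
  note mult_distrib = fps_compose_mult_distrib[of ?v, OF fps_inv_nth_0]
  have "fps_deriv (w oo ?v) = 1"
    using w by (simp add: fps_compose_inv_right)
  then have v': "(fps_deriv w oo ?v) * fps_deriv ?v = 1"
    by (simp add: fps_compose_deriv fps_inv_nth_0)
  have g1: "g * inverse g = 1"
    using g by (simp add: inverse_mult_eq_1')
  have "((a * fps_deriv w) oo ?v) * fps_deriv ((g * f) oo ?v) =
      (a oo ?v) * (fps_deriv (g * f) oo ?v) * ((fps_deriv w oo ?v) * fps_deriv ?v)"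
    unfolding fps_compose_deriv[OF fps_inv_nth_0] mult_distrib[of a] by (simp only: mult_ac)
  then have first: "((a * fps_deriv w) oo ?v) * fps_deriv ((g * f) oo ?v) =
      (a * fps_deriv (g * f)) oo ?v"
    by (simp add: v' mult_distrib)
  have "(b - a * fps_deriv g * inverse g) * (g * f) =
      b * g * f - a * fps_deriv g * f * (g * inverse g)"
    by (simp add: algebra_simps)
  then have "a * fps_deriv (g * f) + (b - a * fps_deriv g * inverse g) * (g * f) =
      g * (a * fps_deriv f + b * f)"
    by (simp add: g1 algebra_simps)
  then show "weighted_subst g ?v (diff_op a b f) =
      diff_op ((a * fps_deriv w) oo ?v) ((b - a * fps_deriv g * inverse g) oo ?v)
        (weighted_subst g ?v f)"
    unfolding diff_op_def weighted_subst_def first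
    by (simp only: flip: mult_distrib fps_compose_add_distrib)
qed

text \<open>The solution is the exponential of a primitive of \<open>s\<close>.\<close>

lemma logarithmic_derivative_solvable:
  fixes s :: "complex fps"
  obtains g where "g $ 0 \<noteq> 0" "fps_deriv g = s * g"
proof
  let ?g = "fps_exp 1 oo fps_integral0 s"
  show "?g $ 0 \<noteq> 0" by simp
  show "fps_deriv ?g = s * ?g"
    by (simp add: fps_compose_deriv fps_deriv_fps_integral)
qed

text \<open>
  By the formula for the conjugate, the new coefficients are \<open>1\<close> and \<open>0\<close> as soon as \<open>w' = 1 / a\<close>
  and \<open>g' / g = \<alpha> / a\<close>.  Among the primitives of \<open>1 / a\<close> only the one that vanishes at the origin
  can be inverted under composition of power series.
\<close>

lemma straightening:
  assumes "a $ 0 \<noteq> 0"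
  obtains \<gamma> where "\<gamma> \<in> SGL" "conjugate \<gamma> (diff_op a \<alpha>) = diff_op 1 0"
    "\<And>D. D \<in> Diff1 \<Longrightarrow> conjugate \<gamma> D \<in> Diff1"
proof -
  have a: "a * inverse a = 1"
    using assms by (simp add: inverse_mult_eq_1')
  define w where "w = fps_integral0 (inverse a)"
  have w': "fps_deriv w = inverse a"
    by (simp add: w_def fps_deriv_fps_integral)
  have w0: "w $ 0 = 0" and w1: "w $ 1 \<noteq> 0"
    using assms by (simp_all add: w_def fps_integral_def)
  obtain g where g0: "g $ 0 \<noteq> 0" and g': "fps_deriv g = (\<alpha> * inverse a) * g"
    by (rule logarithmic_derivative_solvable)
  have "a * fps_deriv g * inverse g = \<alpha> * (a * inverse a) * (g * inverse g)"
    by (simp add: g' mult_ac)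
  then have zero: "\<alpha> - a * fps_deriv g * inverse g = 0"
    using a g0 by (simp add: inverse_mult_eq_1')
  show thesis
  proof (rule that)
    show "weighted_subst g (fps_inv w) \<in> SGL"
      using w0 w1 g0 by (rule weighted_subst_in_SGL)
    show "conjugate (weighted_subst g (fps_inv w)) (diff_op a \<alpha>) = diff_op 1 0"
      unfolding conjugate_diff_op[OF w0 w1 g0] w' zero a by simp
    show "conjugate (weighted_subst g (fps_inv w)) D \<in> Diff1" if "D \<in> Diff1" for D
      using that conjugate_diff_op[OF w0 w1 g0] unfolding Diff1_def by blast
  qed
qed

section \<open>Triples satisfying the relations of sl(2)\<close>

definition sl2_triple :: "fps_op \<Rightarrow> fps_op \<Rightarrow> fps_op \<Rightarrow> bool" where
  "sl2_triple A B C \<longleftrightarrow> A \<in> Diff1 \<and> B \<in> Diff1 \<and> C \<in> Diff1 \<and>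
     commutator B A = A \<and> commutator C B = C \<and> commutator C A = fps_op_scale 2 B"

text \<open>
  In degree \<open>n\<close>, the bracket of \<open>a\<close> with a field vanishing to second order involves only coefficients of
  \<open>a\<close> in degrees below \<open>n\<close>.
\<close>

lemma eigenfield_of_second_order_field_eq_0:
  fixes a b :: "complex fps"
  assumes b: "b $ 0 = 0" "b $ 1 = 0"
    and eq: "b * fps_deriv a - a * fps_deriv b = fps_const t * a" and "t \<noteq> 0"
  shows "a = 0"
proof (rule fps_ext)
  fix n
  show "a $ n = 0 $ n"
  proof (induction n rule: less_induct)
    case (less n)
    have "b $ i * fps_deriv a $ (n - i) = 0" if "i \<le> n" for i
    proof (cases "i = 0 \<or> i = 1")
      case True
      then show ?thesis using b by auto
    next
      case False
      then have "n - i + 1 < n"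
        using that by linarith
      then have "a $ (n - i + 1) = 0"
        using less by simp
      then show ?thesis by simp
    qed
    moreover have "a $ i * fps_deriv b $ (n - i) = 0" if "i \<le> n" for i
      using that b less by (cases "i = n") auto
    ultimately have "(b * fps_deriv a - a * fps_deriv b) $ n = 0"
      by (simp add: fps_mult_nth del: fps_deriv_nth mult_eq_0_iff)
    then show ?case
      using \<open>t \<noteq> 0\<close> by (simp add: eq)
  qed
qed

lemma triple_nonvanishing:
  fixes a b c :: "complex fps"
  assumes ba: "b * fps_deriv a - a * fps_deriv b = a"
    and ca: "c * fps_deriv a - a * fps_deriv c = fps_const 2 * b"
    and "b \<noteq> 0"
  shows "a $ 0 \<noteq> 0 \<or> c $ 0 \<noteq> 0"
proof (rule ccontr)
  assume "\<not> ?thesis"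
  then have 0: "a $ 0 = 0" "c $ 0 = 0" by auto
  have b0: "b $ 0 = 0"
    using arg_cong[OF ca, of "\<lambda>f. f $ 0"] 0 by simp
  (* Linear parts at a common zero bracket like 1x1 matrices, which commute. *)
  have nth1: "(f * fps_deriv h - h * fps_deriv f) $ 1 = 0" if "f $ 0 = 0" "h $ 0 = 0"
    for f h :: "complex fps"
    using that by (simp add: fps_mult_nth mult.commute)
  have b1: "b $ 1 = 0"
    using arg_cong[OF ca, of "\<lambda>f. f $ 1"] nth1[of c a] 0 by simp
  have "a = 0"
    by (rule eigenfield_of_second_order_field_eq_0[OF b0 b1, of _ 1]) (use ba in auto)
  then have "b = 0" using ca by simp
  with \<open>b \<noteq> 0\<close> show False ..
qed

text \<open>
  The relations with \<open>\<partial>\<close> determine the derivatives of all coefficients; the remaining relation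
  then expresses \<open>C\<close> by \<open>B\<close> without any further integration constant.
\<close>

lemma triple_with_partial:
  assumes "sl2_triple (diff_op 1 0) B C"
  obtains c t where "B = diff_op (fps_const t - fps_X) (fps_const c)"
    "C = diff_op ((fps_const t - fps_X)\<^sup>2) (2 * (fps_const t - fps_X) * fps_const c)"
proof -
  from assms obtain b \<beta> d \<delta> where B: "B = diff_op b \<beta>" and C: "C = diff_op d \<delta>"
    by (auto simp: sl2_triple_def Diff1_def)
  have two: "fps_const 2 = (2 :: complex fps)"
    by (simp add: numeral_fps_const)
  have "- fps_deriv b = 1 \<and> fps_deriv \<beta> = 0"
    and db: "d * fps_deriv b - b * fps_deriv d = d \<and> d * fps_deriv \<beta> - b * fps_deriv \<delta> = \<delta>"
    and "- fps_deriv d = 2 * b \<and> - fps_deriv \<delta> = 2 * \<beta>"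
    using assms
    by (simp_all add: sl2_triple_def B C commutator_diff_op diff_op_scale diff_op_eq_iff two)
  then have b': "fps_deriv b = -1" and \<beta>': "fps_deriv \<beta> = 0"
    and d': "fps_deriv d = - (2 * b)" and \<delta>': "fps_deriv \<delta> = - (2 * \<beta>)"
    by (metis minus_minus)+
  have \<beta>: "\<beta> = fps_const (\<beta> $ 0)"
    using \<beta>' by (simp only: fps_deriv_eq_0_iff)
  have "fps_deriv b = fps_deriv (- fps_X)"
    using b' by simp
  then have b: "b = fps_const (b $ 0) - fps_X"
    unfolding fps_deriv_eq_iff by simp
  have "2 * d = 2 * b\<^sup>2"
    using db unfolding b' d' by (simp add: power2_eq_square algebra_simps)
  then have d: "d = b\<^sup>2" by simp
  have \<delta>: "\<delta> = 2 * b * \<beta>"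
    using db unfolding \<beta>' \<delta>' by (simp add: algebra_simps)
  show thesis
    using that[of "b $ 0" "\<beta> $ 0"] B C unfolding d \<delta> by (simp flip: b \<beta>)
qed

lemma span_normal_form:
  "fps_op.span {diff_op 1 0, diff_op (fps_const t - fps_X) (fps_const c),
      diff_op ((fps_const t - fps_X)\<^sup>2) (2 * (fps_const t - fps_X) * fps_const c)} =
    fps_op.span {diff_op 1 0, diff_op fps_X (- fps_const c),
      diff_op (fps_X ^ 2) (- (2 * fps_const c * fps_X))}"
  (is "fps_op.span {?A, ?B, ?C} = fps_op.span {?A, ?Y, ?Z}")
proof -
  have two: "fps_const 2 = (2 :: complex fps)"
    by (simp add: numeral_fps_const)
  note simps = diff_op_scale diff_op_add diff_op_eq_iff two power2_eq_square algebra_simps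
  have B: "?B = fps_op_scale (-1) ?Y + fps_op_scale t ?A"
    by (simp add: simps flip: fps_const_neg)
  have C: "?C = ?Z + fps_op_scale (- (2 * t)) ?Y + fps_op_scale (t * t) ?A"
    by (simp add: simps flip: fps_const_neg fps_const_mult)
  have Y: "?Y = fps_op_scale (-1) ?B + fps_op_scale t ?A"
    by (simp add: simps flip: fps_const_neg)
  have Z: "?Z = ?C + fps_op_scale (- (2 * t)) ?B + fps_op_scale (t * t) ?A"
    by (simp add: simps flip: fps_const_neg fps_const_mult)
  have "?B \<in> fps_op.span {?A, ?Y, ?Z}"
    by (subst B) (intro fps_op.span_add fps_op.span_scale fps_op.span_base; simp)
  moreover have "?C \<in> fps_op.span {?A, ?Y, ?Z}"
    by (subst C) (intro fps_op.span_add fps_op.span_scale fps_op.span_base; simp)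
  moreover have "?Y \<in> fps_op.span {?A, ?B, ?C}"
    by (subst Y) (intro fps_op.span_add fps_op.span_scale fps_op.span_base; simp)
  moreover have "?Z \<in> fps_op.span {?A, ?B, ?C}"
    by (subst Z) (intro fps_op.span_add fps_op.span_scale fps_op.span_base; simp)
  ultimately show ?thesis
    by (simp add: fps_op.span_eq fps_op.span_base)
qed

lemma conjugate_sl2_triple:
  assumes "sl2_triple A B C" "\<gamma> \<in> SGL" "\<And>D. D \<in> Diff1 \<Longrightarrow> conjugate \<gamma> D \<in> Diff1"
  shows "sl2_triple (conjugate \<gamma> A) (conjugate \<gamma> B) (conjugate \<gamma> C)"
proof -
  interpret module_hom fps_op_scale fps_op_scale "conjugate \<gamma>"
    using linear_conjugate[OF assms(2)] by (simp add: module_hom_iff_linear)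
  show ?thesis
    using assms(1,3) by (simp add: sl2_triple_def scale flip: conjugate_commutator[OF assms(2)])
qed

lemma span_nonvanishing_triple:
  assumes triple: "sl2_triple (diff_op a \<alpha>) B C" and "a $ 0 \<noteq> 0"
  shows "\<exists>\<gamma>\<in>SGL. \<exists>c. conjugate \<gamma> ` fps_op.span {diff_op a \<alpha>, B, C} =
    fps_op.span {diff_op 1 0, diff_op fps_X (- fps_const c),
      diff_op (fps_X ^ 2) (- (2 * fps_const c * fps_X))}"
proof -
  obtain \<gamma> where \<gamma>: "\<gamma> \<in> SGL" and A: "conjugate \<gamma> (diff_op a \<alpha>) = diff_op 1 0"
    and "\<And>D. D \<in> Diff1 \<Longrightarrow> conjugate \<gamma> D \<in> Diff1"
    using straightening[OF \<open>a $ 0 \<noteq> 0\<close>] by metis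
  with triple have "sl2_triple (diff_op 1 0) (conjugate \<gamma> B) (conjugate \<gamma> C)"
    using conjugate_sl2_triple by metis
  then obtain c t where BC: "conjugate \<gamma> B = diff_op (fps_const t - fps_X) (fps_const c)"
    "conjugate \<gamma> C = diff_op ((fps_const t - fps_X)\<^sup>2) (2 * (fps_const t - fps_X) * fps_const c)"
    by (rule triple_with_partial)
  interpret module_hom fps_op_scale fps_op_scale "conjugate \<gamma>"
    using linear_conjugate[OF \<gamma>] by (simp add: module_hom_iff_linear)
  have "conjugate \<gamma> ` fps_op.span {diff_op a \<alpha>, B, C} =
      fps_op.span {diff_op 1 0, conjugate \<gamma> B, conjugate \<gamma> C}"
    by (simp add: A flip: span_image)
  then show ?thesis
    using \<gamma> unfolding BC span_normal_form by blast
qed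

text \<open>This is the symmetry \<open>L\<^sub>k \<mapsto> \<plusminus>L\<^sub>-\<^sub>k\<close> of sl(2), with the sign \<open>-\<close> for \<open>k = 0\<close> only.\<close>

lemma sl2_triple_swap:
  assumes "sl2_triple A B C"
  shows "sl2_triple C (- B) A"
proof -
  have neg: "- diff_op b \<beta> = diff_op (- b) (- \<beta>)" for b \<beta>
    by (rule ext) (simp add: diff_op_def algebra_simps)
  from assms obtain a \<alpha> b \<beta> c \<delta>
    where "A = diff_op a \<alpha>" "B = diff_op b \<beta>" "C = diff_op c \<delta>"
    by (auto simp: sl2_triple_def Diff1_def)
  with assms show ?thesis
    by (auto simp: sl2_triple_def neg commutator_diff_op diff_op_scale diff_op_eq_iff
        Diff1_def algebra_simps)
qed

lemma span_swap: "fps_op.span {C, - B, A} = fps_op.span {A, B, C}"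
proof -
  have "B \<in> fps_op.span {C, - B, A}"
    using fps_op.span_neg[of "- B" "{C, - B, A}"] by (simp add: fps_op.span_base)
  moreover have "- B \<in> fps_op.span {A, B, C}"
    by (intro fps_op.span_neg fps_op.span_base) simp
  ultimately show ?thesis
    by (simp add: fps_op.span_eq fps_op.span_base)
qed

section \<open>Representations of sl(2)\<close>

lemma sl2_triple_of_hom:
  assumes "sl2_hom_Diff1 \<rho>"
  shows "sl2_triple (\<rho> (L (-1))) (\<rho> (L 0)) (\<rho> (L 1))"
proof -
  interpret module_hom sl2_scale fps_op_scale \<rho>
    using assms by (simp add: sl2_hom_Diff1_def module_hom_iff_linear)
  have "commutator (\<rho> (L i)) (\<rho> (L j)) = fps_op_scale (of_int (i - j)) (\<rho> (L (i + j)))"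
    if "i \<in> {-1, 0, 1}" "j \<in> {-1, 0, 1}" for i j
    using assms sl2_bracket_L[OF that] scale by (metis sl2_hom_Diff1_def)
  from this[of 0 "-1"] this[of 1 0] this[of 1 "-1"] show ?thesis
    using assms by (auto simp: sl2_triple_def sl2_hom_Diff1_def)
qed

lemma range_sl2_hom:
  assumes "sl2_hom_Diff1 \<rho>"
  shows "range \<rho> = fps_op.span {\<rho> (L (-1)), \<rho> (L 0), \<rho> (L 1)}"
proof -
  interpret module_hom sl2_scale fps_op_scale \<rho>
    using assms by (simp add: sl2_hom_Diff1_def module_hom_iff_linear)
  have "x \<in> sl2.span {L (-1), L 0, L 1}" for x
    by (subst sl2_expand)
      (intro sl2.span_add sl2.span_scale sl2.span_base; simp)
  then have "sl2.span {L (-1), L 0, L 1} = UNIV" by blast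
  then show ?thesis
    using span_image[of "{L (-1), L 0, L 1}"] by simp
qed

theorem theorem3p11:
  fixes \<rho> :: "sl2 \<Rightarrow> fps_op"
  assumes "sl2_hom_Diff1 \<rho>"
    and "first_order (\<rho> (L 0))"
  shows "\<exists>\<gamma>\<in>SGL. \<exists>c::complex.
           range (conj_rep \<gamma> \<rho>) =
             fps_op.span
               {diff_op 1 0,
                diff_op fps_X (- fps_const c),
                diff_op (fps_X ^ 2) (- (2 * fps_const c * fps_X))}"
proof -
  have triple: "sl2_triple (\<rho> (L (-1))) (\<rho> (L 0)) (\<rho> (L 1))"
    using assms(1) by (rule sl2_triple_of_hom)
  obtain b \<beta> where B: "\<rho> (L 0) = diff_op b \<beta>" and "b \<noteq> 0"
    using assms(2) by (auto simp: first_order_def)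
  obtain a \<alpha> c \<delta> where A: "\<rho> (L (-1)) = diff_op a \<alpha>" and C: "\<rho> (L 1) = diff_op c \<delta>"
    using triple by (auto simp: sl2_triple_def Diff1_def)
  have "a $ 0 \<noteq> 0 \<or> c $ 0 \<noteq> 0"
    using triple \<open>b \<noteq> 0\<close>
    by (intro triple_nonvanishing[of b a c])
      (auto simp: sl2_triple_def A B C commutator_diff_op diff_op_scale diff_op_eq_iff)
  then have "\<exists>\<gamma>\<in>SGL. \<exists>k. conjugate \<gamma> ` range \<rho> =
    fps_op.span {diff_op 1 0, diff_op fps_X (- fps_const k),
      diff_op (fps_X ^ 2) (- (2 * fps_const k * fps_X))}"
  proof
    assume "a $ 0 \<noteq> 0"
    with triple show ?thesis
      unfolding range_sl2_hom[OF assms(1)] A by (rule span_nonvanishing_triple)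
  next
    assume "c $ 0 \<noteq> 0"
    with sl2_triple_swap[OF triple] show ?thesis
      unfolding range_sl2_hom[OF assms(1)] C span_swap[of "diff_op c \<delta>", symmetric]
      by (rule span_nonvanishing_triple)
  qed
  moreover have "range (conj_rep \<gamma> \<rho>) = conjugate \<gamma> ` range \<rho>" for \<gamma>
    by (auto simp: conj_rep_def conjugate_def)
  ultimately show ?thesis by simp
qed

end
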